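(* Let $G\subset\mathbb{F}_q^k$ be an arc and let $n\in\mathbb{N}$ be a natural number such that \[ n+k-1\le |G|\le \frac{q+2k-2+n}{2}. \] If the column space of the matrix $M_G^{\uparrow n}$ (over $\mathbb{F}_q$) contains a vector of weight one (a vector with exactly one nonzero coordinate), then the arc $G$ cannot be extended to an arc of size $q+2k-1+n-|G|$, i.e. there is no arc of that size in $\mathbb{F}_q^k$ containing $G$ as a subfamily.
   Context: $\mathbb{F}_q$ is a finite field of order $q$ and characteristic $p$. An arc in $\mathbb{F}_q^k$ is an ordered family of at least $k$ vectors in which every subfamily of size $k$ is a basis of $\mathbb{F}_q^k$; subfamilies inherit the order. $\binom{X}{m}$ is the set of $m$-subsets of $X$. For a basis $B$ of $\mathbb{F}_q^k$, a vector $u$ and $C\in\binom{G}{k-1}$, $\det(u,C)_B$ is the determinant of the $k\times k$ matrix whose first row is $u$ written with respect to $B$ and whose last $k-1$ rows are the elements of $C$ written with respect to $B$ in the order inherited from $G$. For $0\le n\le|G|-k+1$ and a fixed basis $B$, $M_G^{\uparrow n}$ has rows indexed by $\binom{G}{k-1}$, columns indexed by ordered pairs $(U,A)$ with $U\in\binom{G}{n}$, $A\in\binom{G\setminus U}{k-2}$, and $(C,(U,A))$-entry $\prod_{u\in U}\det(u,C)_B$ if $A\subset C\subset G\setminus U$ and $0$ otherwise. *)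

theory Defs
  imports
    "Jordan_Normal_Form.VS_Connect"
    "Jordan_Normal_Form.Determinant"
    "HOL-Library.Sublist"
    "HOL-Library.Cardinality"
begin

text \<open>
  Ordered families of vectors of the \<open>k\<close>-dimensional coordinate space are lists.  A subfamily of
  \<open>G\<close> is given by a set \<open>I\<close> of positions; \<^term>\<open>nths G I\<close> lists its members in the order inherited
  from \<open>G\<close>.
\<close>

definition ordered_basis :: "nat \<Rightarrow> 'a :: field vec list \<Rightarrow> bool" where
  "ordered_basis k B \<longleftrightarrow>
     distinct B \<and> vectorspace.basis class_ring (module_vec TYPE('a) k) (set B)"

definition subsets_of_size :: "'b set \<Rightarrow> nat \<Rightarrow> 'b set set" where
  "subsets_of_size X m = {Y. Y \<subseteq> X \<and> finite Y \<and> card Y = m}"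

definition vec_arc :: "nat \<Rightarrow> 'a :: field vec list \<Rightarrow> bool" where
  "vec_arc k G \<longleftrightarrow>
     set G \<subseteq> carrier_vec k \<and> k \<le> length G \<and>
     (\<forall>I \<in> subsets_of_size {..<length G} k. ordered_basis k (nths G I))"

text \<open>The unique \<open>c\<close> with \<open>v = c\<^sub>0 B\<^sub>0 + \<dots> + c\<^bsub>k-1\<^esub> B\<^bsub>k-1\<^esub>\<close>, for an ordered basis \<open>B\<close>.\<close>

definition coord_vec :: "nat \<Rightarrow> 'a :: field vec list \<Rightarrow> 'a vec \<Rightarrow> 'a vec" where
  "coord_vec k B v = (THE c. c \<in> carrier_vec k \<and> mat_of_cols k B *\<^sub>v c = v)"

definition det_wrt :: "nat \<Rightarrow> 'a :: field vec list \<Rightarrow> 'a vec list \<Rightarrow> 'a" where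
  "det_wrt k B vs = det (mat_of_rows k (map (coord_vec k B) vs))"

text \<open>
  The sizes \<open>k - 1\<close> and \<open>k - 2\<close> are expressed without truncated subtraction: there are no rows for
  \<open>k = 0\<close> and no columns for \<open>k \<le> 1\<close>.
\<close>

definition arc_rows :: "nat \<Rightarrow> 'a vec list \<Rightarrow> nat set set" where
  "arc_rows k G = {C. C \<subseteq> {..<length G} \<and> card C + 1 = k}"

definition arc_cols :: "nat \<Rightarrow> nat \<Rightarrow> 'a vec list \<Rightarrow> (nat set \<times> nat set) set" where
  "arc_cols k n G =
     {(U, A). U \<in> subsets_of_size {..<length G} n \<and> A \<subseteq> {..<length G} - U \<and> card A + 2 = k}"

definition arc_matrix ::
  "nat \<Rightarrow> 'a :: field vec list \<Rightarrow> 'a vec list \<Rightarrow> nat set \<Rightarrow> nat set \<times> nat set \<Rightarrow> 'a" where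
  "arc_matrix k B G C = (\<lambda>(U, A).
     if A \<subseteq> C \<and> C \<subseteq> {..<length G} - U
     then \<Prod>u\<in>U. det_wrt k B (G ! u # nths G C)
     else 0)"

text \<open>
  A matrix with finite row index set \<open>R\<close> and column index set \<open>S\<close> is a function; the vectors indexed
  by \<open>R\<close> are the functions vanishing outside \<open>R\<close>.
\<close>

definition column_space :: "'r set \<Rightarrow> 's set \<Rightarrow> ('r \<Rightarrow> 's \<Rightarrow> 'a :: field) \<Rightarrow> ('r \<Rightarrow> 'a) set" where
  "column_space R S M = {v. \<exists>x. v = (\<lambda>r. if r \<in> R then \<Sum>s\<in>S. x s * M r s else 0)}"

definition weight :: "'r set \<Rightarrow> ('r \<Rightarrow> 'a :: zero) \<Rightarrow> nat" where
  "weight R v = card {r \<in> R. v r \<noteq> 0}"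

end

theory Submission
  imports
    Defs
    "Jordan_Normal_Form.DL_Rank"
    "HOL-Computational_Algebra.Polynomial"
begin

text \<open>
  Let the arc \<open>H\<close> extend \<open>G\<close> to the forbidden size.  The row vector with \<open>C\<close>-entry
  \<open>\<Prod>\<^bsub>y\<in>H-C\<^esub> det(y,C)\<^sup>-\<^sup>1 \<Prod>\<^bsub>y\<in>G-C\<^esub> det(y,C)\<^sup>-\<^sup>1\<close> has no zero entry and is orthogonal to every column
  of the matrix, so no vector of weight one is a combination of columns.

  For the column \<open>(U,A)\<close>, orthogonality is a statement about the plane obtained by factoring out the
  span of \<open>A\<close>: if \<open>S \<subseteq> X\<close> are sets of pairwise independent vectors of the plane over a field with \<open>q\<close>
  elements and \<open>|X| + |S| = q + 3\<close>, then
  \<open>\<Sum>\<^bsub>x\<in>S\<^esub> \<Prod>\<^bsub>y\<in>X-x\<^esub> [y,x]\<^sup>-\<^sup>1 \<Prod>\<^bsub>y\<in>S-x\<^esub> [y,x]\<^sup>-\<^sup>1 = 0\<close>.  With one point of \<open>S\<close> moved to infinity, Wilson's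
  theorem turns the product over \<open>X\<close> into one over the complement of \<open>X\<close>, and the identity compares
  leading coefficients in Lagrange interpolation.  Every summand has \<open>q + 1\<close> factors, so the signs
  caused by reordering the rows of the determinants cancel, and Segre's lemma of tangents is not
  needed.
\<close>

section \<open>Wilson's theorem and Lagrange interpolation over a finite field\<close>

text \<open>Multiplication by \<open>x\<close> permutes the nonzero elements, so it fixes their
  product while scaling it by a power of \<open>x\<close>.\<close>

lemma finite_field_power_card_minus_1:
  fixes x :: "'a :: {field, finite}"
  assumes "x \<noteq> 0"
  shows "x ^ (CARD('a) - 1) = 1"
proof -
  let ?N = "UNIV - {0 :: 'a}"
  have bij: "bij_betw ((*) x) ?N ?N"
    by (rule bij_betwI[where g = "\<lambda>y. y / x"]) (use assms in auto)
  have "(\<Prod>y\<in>?N. y) = (\<Prod>y\<in>?N. x * y)"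
    by (rule prod.reindex_bij_betw[OF bij, symmetric])
  also have "\<dots> = x ^ card ?N * (\<Prod>y\<in>?N. y)"
    by (simp add: prod.distrib)
  finally have "x ^ card ?N * (\<Prod>y\<in>?N. y) = 1 * (\<Prod>y\<in>?N. y)" by simp
  moreover have "(\<Prod>y\<in>?N. y) \<noteq> 0" by simp
  ultimately have "x ^ card ?N = 1" by (simp only: mult_cancel_right) simp
  thus ?thesis by (simp add: card_Diff_singleton)
qed

text \<open>Each summand of the plane identity has \<open>CARD('a) + 1\<close> determinant factors;
  a scalar common to all of them therefore contributes only its square, and a sign contributes
  1.\<close>

lemma finite_field_power_card_plus_1:
  fixes x :: "'a :: {field, finite}"
  shows "x ^ (CARD('a) + 1) = x\<^sup>2"
proof (cases "x = 0")
  case False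
  have "CARD('a) > 0" by (simp add: card_gt_0_iff)
  hence "CARD('a) + 1 = (CARD('a) - 1) + 2" by simp
  thus ?thesis using finite_field_power_card_minus_1[OF False]
    by (simp only: power_add) simp
qed simp

text \<open>Wilson's theorem: the product of all \<open>[:- y, 1:]\<close> with \<open>y\<close>
  nonzero equals X^(q-1) - 1, both being monic of degree q - 1 with the same roots. The values at 0
  are compared.\<close>

lemma finite_field_prod_nonzero:
  "(\<Prod>y\<in>UNIV - {0 :: 'a :: {field, finite}}. y) = - 1"
proof -
  let ?N = "UNIV - {0 :: 'a}"
  let ?p = "\<Prod>y\<in>?N. [:- y, 1:]"
  let ?q = "monom 1 (card ?N) - [:1 :: 'a:]"
  have N: "card ?N = CARD('a) - 1" by (simp add: card_Diff_singleton)
  \<comment> \<open>A field has at least two elements, so the exponent q - 1 is positive and the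
    constant term of \<open>?q\<close> affects neither its degree nor its leading
    coefficient.\<close>
  have "{0, 1 :: 'a} \<subseteq> UNIV" by simp
  hence "card {0, 1 :: 'a} \<le> CARD('a)" by (rule card_mono[rotated]) simp
  hence pos: "card ?N > 0" by (simp add: N)
  have degp: "degree ?p = card ?N" by (subst degree_prod_eq_sum_degree) auto
  have "?p = ?q"
  proof (rule poly_eqI_degree_lead_coeff[where A = ?N and n = "card ?N"])
    show "degree ?q \<le> card ?N" by (intro degree_diff_le degree_monom_le) simp
    have "coeff ?p (card ?N) = lead_coeff ?p" using degp by simp
    also have "\<dots> = 1" by (subst lead_coeff_prod) simp
    also have "\<dots> = coeff ?q (card ?N)" using pos by (simp add: coeff_pCons split: nat.split)
    finally show "coeff ?p (card ?N) = coeff ?q (card ?N)" .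
    show "poly ?p x = poly ?q x" if "x \<in> ?N" for x
    proof -
      have "poly ?p x = 0" using that by (auto simp: poly_prod)
      moreover have "poly ?q x = 0"
        using finite_field_power_card_minus_1[of x] that by (simp add: poly_monom N)
      ultimately show ?thesis by simp
    qed
  qed (use degp in auto)
  hence "poly ?p 0 = poly ?q 0" by simp
  hence "(\<Prod>y\<in>?N. - y) = - 1" using pos by (simp add: poly_prod poly_monom)
  \<comment> \<open>Negation permutes the nonzero elements, which avoids a case distinction on the
    parity of q.\<close>
  moreover have "(\<Prod>y\<in>?N. - y) = (\<Prod>y\<in>?N. y)"
    by (rule prod.reindex_bij_witness[of _ uminus uminus]) auto
  ultimately show ?thesis by simp
qed

lemma finite_field_prod_differences:
  fixes x :: "'a :: {field, finite}"
  shows "(\<Prod>y\<in>UNIV - {x}. y - x) = - 1"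
proof -
  have "(\<Prod>y\<in>UNIV - {x}. y - x) = (\<Prod>y\<in>UNIV - {0 :: 'a}. y)"
    by (rule prod.reindex_bij_witness[of _ "\<lambda>y. y + x" "\<lambda>y. y - x"]) auto
  thus ?thesis by (simp add: finite_field_prod_nonzero)
qed

text \<open>The monic polynomial with root set \<open>T\<close> has degree
  \<open>card Q - 1\<close>, so it is its own interpolant at the nodes \<open>Q\<close>. Its leading
  coefficient 1 is the sum of the interpolation weights \<open>w x\<close>.\<close>

lemma lagrange_leading_coefficient:
  fixes Q T :: "'a :: field set"
  assumes "finite Q" "finite T" "card Q = card T + 1"
  shows "(\<Sum>x\<in>Q. (\<Prod>y\<in>T. y - x) / (\<Prod>y\<in>Q - {x}. y - x)) = 1"
proof -
  define w where "w x = (\<Prod>y\<in>T. x - y) / (\<Prod>y\<in>Q - {x}. x - y)" for x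
  let ?p = "\<Sum>x\<in>Q. Polynomial.smult (w x) (\<Prod>y\<in>Q - {x}. [:- y, 1:])"
  let ?q = "\<Prod>y\<in>T. [:- y, 1:]"
  have deg: "degree (\<Prod>y\<in>Q - {x}. [:- y, 1:]) = card T" if "x \<in> Q" for x
    using that assms by (subst degree_prod_eq_sum_degree) auto
  have lead: "coeff (\<Prod>y\<in>Q - {x}. [:- y, 1:]) (card T) = 1" if "x \<in> Q" for x
    using lead_coeff_prod[of "\<lambda>y. [:- y, 1:]" "Q - {x}"] deg[OF that] by simp
  have degq: "degree ?q = card T" using assms by (subst degree_prod_eq_sum_degree) auto
  have leadq: "coeff ?q (card T) = 1"
    using lead_coeff_prod[of "\<lambda>y. [:- y, 1:]" T] degq by simp
  have "?p = ?q"
  proof (rule poly_eqI_degree[where A = Q])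
    have "degree ?p \<le> card T" using deg by (intro degree_sum_le) (auto simp: assms)
    thus "degree ?p < card Q" using assms by simp
    show "degree ?q < card Q" using degq assms by simp
    show "poly ?p z = poly ?q z" if "z \<in> Q" for z
    proof -
      have "poly ?p z = (\<Sum>x\<in>Q. w x * (\<Prod>y\<in>Q - {x}. z - y))"
        by (simp add: poly_sum poly_prod)
      also have "\<dots> = (\<Sum>x\<in>{z}. w x * (\<Prod>y\<in>Q - {x}. z - y))"
        by (rule sum.mono_neutral_right) (use assms that in \<open>auto simp: prod_zero_iff\<close>)
      also have "\<dots> = (\<Prod>y\<in>T. z - y)"
        using assms(1) by (auto simp: w_def)
      finally show ?thesis by (simp add: poly_prod)
    qed
  qed
  hence "coeff ?p (card T) = 1" using leadq by simp
  hence "(\<Sum>x\<in>Q. w x) = 1" by (simp add: coeff_sum lead)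
  moreover have "w x = (\<Prod>y\<in>T. y - x) / (\<Prod>y\<in>Q - {x}. y - x)" if "x \<in> Q" for x
  proof -
    have neg: "(\<Prod>y\<in>Y. x - y) = (- 1) ^ card Y * (\<Prod>y\<in>Y. y - x)" for Y
    proof -
      have "(\<Prod>y\<in>Y. x - y) = (\<Prod>y\<in>Y. (- 1) * (y - x))" by simp
      also have "\<dots> = (- 1) ^ card Y * (\<Prod>y\<in>Y. y - x)" by (simp only: prod.distrib prod_constant)
      finally show ?thesis .
    qed
    \<comment> \<open>Numerator and denominator have equally many factors, so reversing every
      difference changes nothing.\<close>
    have "card (Q - {x}) = card T" using that assms by simp
    thus ?thesis unfolding w_def neg by simp
  qed
  ultimately show ?thesis by simp
qed

text \<open>By Wilson's theorem the inverse of the product over \<open>R - {x}\<close> is minus the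
  product over the complement of \<open>R\<close>. The size condition makes this complement one
  element smaller than \<open>Q\<close>, as interpolation requires.\<close>

lemma finite_field_double_difference_sum:
  fixes R Q :: "'a :: {field, finite} set"
  assumes "Q \<subseteq> R" "card R + card Q = CARD('a) + 1"
  shows "(\<Sum>x\<in>Q. inverse (\<Prod>y\<in>R - {x}. y - x) * inverse (\<Prod>y\<in>Q - {x}. y - x)) = - 1"
proof -
  let ?T = "UNIV - R"
  have "card ?T = CARD('a) - card R" by (simp add: card_Diff_subset)
  moreover have "card R \<le> CARD('a)" by (simp add: card_mono)
  ultimately have card: "card Q = card ?T + 1" using assms(2) by simp
  have "inverse (\<Prod>y\<in>R - {x}. y - x) = - (\<Prod>y\<in>?T. y - x)" if "x \<in> Q" for x
  proof -
    have UN: "UNIV - {x} = (R - {x}) \<union> ?T" using that assms(1) by blast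
    have "(\<Prod>y\<in>R - {x}. y - x) * (\<Prod>y\<in>?T. y - x) = (\<Prod>y\<in>UNIV - {x}. y - x)"
      unfolding UN by (rule prod.union_disjoint[symmetric]) auto
    hence "(\<Prod>y\<in>R - {x}. y - x) * (\<Prod>y\<in>?T. y - x) = - 1"
      by (simp only: finite_field_prod_differences)
    hence "(\<Prod>y\<in>R - {x}. y - x) * - (\<Prod>y\<in>?T. y - x) = 1" by simp
    thus ?thesis by (rule inverse_unique)
  qed
  hence "(\<Sum>x\<in>Q. inverse (\<Prod>y\<in>R - {x}. y - x) * inverse (\<Prod>y\<in>Q - {x}. y - x))
      = - (\<Sum>x\<in>Q. (\<Prod>y\<in>?T. y - x) / (\<Prod>y\<in>Q - {x}. y - x))"
    by (simp add: sum_negf divide_inverse)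
  thus ?thesis using lagrange_leading_coefficient[OF _ _ card] by simp
qed

section \<open>The double product identity in the plane\<close>

text \<open>\<open>D\<close> is the determinant in the coordinates \<open>(a, b)\<close> up to the
  factor \<open>c\<close>, and \<open>s\<close> is the point at infinity. In terms of the slopes
  \<open>r = a / b\<close> of the other points, the summand at \<open>s\<close> is
  \<open>inverse K\<close>, and the remaining ones are \<open>inverse K\<close> times those of the
  affine identity, whose sum is -1.\<close>

lemma plane_double_product_sum:
  fixes D :: "'v \<Rightarrow> 'v \<Rightarrow> 'a :: {field, finite}"
  assumes "finite X" "S \<subseteq> X" "s \<in> S" "card X + card S = CARD('a) + 3"
    and D: "\<And>x y. x \<in> X \<Longrightarrow> y \<in> X \<Longrightarrow> D y x = c * (a y * b x - b y * a x)"
    and nz: "\<And>x y. x \<in> X \<Longrightarrow> y \<in> X \<Longrightarrow> x \<noteq> y \<Longrightarrow> D y x \<noteq> 0"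
    and s: "a s = 1" "b s = 0"
  shows "(\<Sum>x\<in>S. inverse (\<Prod>y\<in>X - {x}. D y x) * inverse (\<Prod>y\<in>S - {x}. D y x)) = 0"
proof -
  define X' S' where "X' = X - {s}" and "S' = S - {s}"
  have fin: "finite X'" "finite S'" "finite S"
    using assms(1,2) by (auto simp: X'_def S'_def finite_subset)
  have sub: "S' \<subseteq> X'" "X' \<subseteq> X" "s \<notin> X'" "s \<notin> S'" "s \<in> X"
    using assms(2,3) by (auto simp: X'_def S'_def)
  have X: "X = insert s X'" and S: "S = insert s S'"
    using assms(2,3) by (auto simp: X'_def S'_def)
  have card: "card X' + card S' = CARD('a) + 1"
    using assms(4) fin sub by (simp add: X S)
  define r where "r y = a y / b y" for y
  have Ds: "D s y = c * b y" "D y s = (- c) * b y" if "y \<in> X'" for y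
    using D[of s y] D[of y s] that sub s by auto
  have b: "b y \<noteq> 0" and c: "c \<noteq> 0" if "y \<in> X'" for y
    using Ds[OF that] nz[of y s] that sub by auto
  have Dr: "D y x = (c * b x) * (b y * (r y - r x))" if "x \<in> X'" "y \<in> X'" for x y
  proof -
    have "D y x = c * (a y * b x - b y * a x)" using D that sub by blast
    also have "\<dots> = (c * b x) * (b y * (r y - r x))"
      using b[OF that(1)] b[OF that(2)] by (simp add: r_def field_simps)
    finally show ?thesis .
  qed
  have inj: "inj_on r X'"
  proof (rule inj_onI, rule ccontr)
    fix x y assume *: "x \<in> X'" "y \<in> X'" "r x = r y" "x \<noteq> y"
    hence "D y x = 0" using Dr by simp
    thus False using nz[of x y] * sub by auto
  qed
  \<comment> \<open>The factor common to all denominators; its \<open>c\<^sup>2\<close> is what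
    remains of a power with exponent \<open>CARD('a) + 1\<close>.\<close>
  define K where "K = c\<^sup>2 * prod b X' * prod b S'"
  have at_s: "(\<Prod>y\<in>X - {s}. D y s) * (\<Prod>y\<in>S - {s}. D y s) = K"
  proof -
    have *: "(\<Prod>y\<in>Y. D y s) = (- c) ^ card Y * prod b Y" if "Y \<subseteq> X'" for Y
    proof -
      have "(\<Prod>y\<in>Y. D y s) = (\<Prod>y\<in>Y. (- c) * b y)"
        using that Ds by (intro prod.cong) auto
      also have "\<dots> = (- c) ^ card Y * prod b Y" by (simp only: prod.distrib prod_constant)
      finally show ?thesis .
    qed
    have "(\<Prod>y\<in>X - {s}. D y s) * (\<Prod>y\<in>S - {s}. D y s)
        = (- c) ^ (card X' + card S') * prod b X' * prod b S'"
      using *[of X'] *[OF sub(1)] by (simp add: X'_def[symmetric] S'_def[symmetric] power_add)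
    thus ?thesis unfolding card finite_field_power_card_plus_1 by (simp add: K_def)
  qed
  have at_x: "(\<Prod>y\<in>X - {x}. D y x) * (\<Prod>y\<in>S - {x}. D y x)
      = K * ((\<Prod>y\<in>X' - {x}. r y - r x) * (\<Prod>y\<in>S' - {x}. r y - r x))" if x: "x \<in> S'" for x
  proof -
    \<comment> \<open>The extra \<open>b x\<close> completes the product of \<open>b\<close> over
      \<open>Y - {x}\<close> to one over \<open>Y\<close>. The point \<open>s\<close> supplies the
      last of the \<open>card Y\<close> factors \<open>c * b x\<close>.\<close>
    have *: "(\<Prod>y\<in>insert s Y - {x}. D y x) * b x
        = (c * b x) ^ card Y * prod b Y * (\<Prod>y\<in>Y - {x}. r y - r x)"
      if Y: "Y \<subseteq> X'" "x \<in> Y" for Y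
    proof -
      have finY: "finite Y" using Y fin finite_subset by blast
      have "insert s Y - {x} = insert s (Y - {x})" "s \<notin> Y - {x}" using Y sub by auto
      hence "(\<Prod>y\<in>insert s Y - {x}. D y x) = D s x * (\<Prod>y\<in>Y - {x}. D y x)"
        using finY by simp
      also have "D s x = c * b x" using Y Ds by auto
      also have "(\<Prod>y\<in>Y - {x}. D y x) = (\<Prod>y\<in>Y - {x}. (c * b x) * (b y * (r y - r x)))"
        using Y Dr by (intro prod.cong) auto
      also have "\<dots> = (c * b x) ^ card (Y - {x}) * (prod b (Y - {x}) * (\<Prod>y\<in>Y - {x}. r y - r x))"
        by (simp add: prod.distrib power_mult_distrib)
      finally have "(\<Prod>y\<in>insert s Y - {x}. D y x) * b x
        = (c * b x) ^ Suc (card (Y - {x})) * (b x * prod b (Y - {x})) * (\<Prod>y\<in>Y - {x}. r y - r x)"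
        by (simp only: power_Suc mult_ac)
      also have "Suc (card (Y - {x})) = card Y" using finY Y by (simp only: card_Suc_Diff1)
      also have "b x * prod b (Y - {x}) = prod b Y" using finY Y by (simp only: prod.remove)
      finally show ?thesis .
    qed
    have xX: "x \<in> X'" using x sub by auto
    have "((\<Prod>y\<in>X - {x}. D y x) * b x) * ((\<Prod>y\<in>S - {x}. D y x) * b x)
       = (c * b x) ^ (card X' + card S') * prod b X' * prod b S' *
         ((\<Prod>y\<in>X' - {x}. r y - r x) * (\<Prod>y\<in>S' - {x}. r y - r x))"
      unfolding X S *[OF subset_refl xX] *[OF sub(1) x] by (simp add: power_add mult_ac)
    also have "\<dots> = K * ((\<Prod>y\<in>X' - {x}. r y - r x) * (\<Prod>y\<in>S' - {x}. r y - r x)) * (b x)\<^sup>2"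
      unfolding card finite_field_power_card_plus_1 by (simp add: K_def power_mult_distrib)
    \<comment> \<open>The two auxiliary factors \<open>b x\<close> on the left match the
      \<open>(b x)\<^sup>2\<close> left over from the power on the right.\<close>
    finally have "((\<Prod>y\<in>X - {x}. D y x) * (\<Prod>y\<in>S - {x}. D y x)) * (b x)\<^sup>2
        = K * ((\<Prod>y\<in>X' - {x}. r y - r x) * (\<Prod>y\<in>S' - {x}. r y - r x)) * (b x)\<^sup>2"
      by (simp only: power2_eq_square mult_ac)
    thus ?thesis using b[OF xX] by simp
  qed
  have im: "(\<Prod>y\<in>r ` Y - {r x}. y - r x) = (\<Prod>y\<in>Y - {x}. r y - r x)"
    if "Y \<subseteq> X'" "x \<in> Y" for x Y
  proof -
    have "r ` Y - {r x} = r ` (Y - {x})" "inj_on r (Y - {x})"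
      using inj that by (auto simp: inj_on_def)
    thus ?thesis by (simp add: prod.reindex)
  qed
  have injS: "inj_on r S'" using inj sub(1) inj_on_subset by blast
  have "- 1 = (\<Sum>x\<in>r ` S'. inverse (\<Prod>y\<in>r ` X' - {x}. y - x) * inverse (\<Prod>y\<in>r ` S' - {x}. y - x))"
    using sub inj injS card
    by (subst finite_field_double_difference_sum) (auto simp: card_image)
  also have "\<dots> = (\<Sum>x\<in>S'. inverse (\<Prod>y\<in>X' - {x}. r y - r x) * inverse (\<Prod>y\<in>S' - {x}. r y - r x))"
    unfolding sum.reindex[OF injS] o_def using im[of X'] im[OF sub(1)] sub(1)
    by (intro sum.cong) auto
  finally have sum': "(\<Sum>x\<in>S'. inverse (\<Prod>y\<in>X' - {x}. r y - r x) * inverse (\<Prod>y\<in>S' - {x}. r y - r x)) = - 1"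
    by simp
  have "(\<Sum>x\<in>S. inverse (\<Prod>y\<in>X - {x}. D y x) * inverse (\<Prod>y\<in>S - {x}. D y x))
      = (\<Sum>x\<in>S. inverse ((\<Prod>y\<in>X - {x}. D y x) * (\<Prod>y\<in>S - {x}. D y x)))"
    by simp
  also have "\<dots> = inverse ((\<Prod>y\<in>X - {s}. D y s) * (\<Prod>y\<in>S - {s}. D y s)) +
      (\<Sum>x\<in>S'. inverse ((\<Prod>y\<in>X - {x}. D y x) * (\<Prod>y\<in>S - {x}. D y x)))"
    unfolding S'_def by (rule sum.remove) (use fin assms in auto)
  also have "\<dots> = inverse K + (\<Sum>x\<in>S'. inverse K *
      (inverse (\<Prod>y\<in>X' - {x}. r y - r x) * inverse (\<Prod>y\<in>S' - {x}. r y - r x)))"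
    using at_s at_x by simp
  also have "\<dots> = 0" unfolding sum_distrib_left[symmetric] sum' by simp
  finally show ?thesis .
qed

section \<open>Bases, determinants and coordinates\<close>

lemma ordered_basisD:
  fixes B :: "'a :: field vec list"
  assumes "ordered_basis k B"
  shows "length B = k" "set B \<subseteq> carrier_vec k" "det (mat_of_rows k B) \<noteq> 0"
proof -
  interpret vec_space "TYPE('a)" k .
  have d: "distinct B" and bas: "basis (set B)" using assms by (auto simp: ordered_basis_def)
  show len: "length B = k"
    using dim_basis[OF finite_set bas] distinct_card[OF d] by (simp add: dim_is_n)
  show car: "set B \<subseteq> carrier_vec k" using bas by (auto simp: basis_def)
  let ?A = "mat_of_cols k B"
  have A: "?A \<in> carrier_mat k k" using len by (simp add: carrier_matI)
  have cols: "cols ?A = B" using car by (simp add: cols_mat_of_cols)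
  have "rank ?A = k"
    using lin_indpt_full_rank[OF A] d bas unfolding cols by (simp add: basis_def)
  hence "det ?A \<noteq> 0" using det_rank_iff[OF A] by simp
  moreover have "mat_of_rows k B = ?A\<^sup>T" by (simp add: transpose_mat_of_cols)
  ultimately show "det (mat_of_rows k B) \<noteq> 0" using det_transpose[OF A] by simp
qed

lemma invertible_matE:
  fixes A :: "'a :: field mat"
  assumes "A \<in> carrier_mat n n" "det A \<noteq> 0"
  obtains A' where "A' \<in> carrier_mat n n" "A * A' = 1\<^sub>m n" "A' * A = 1\<^sub>m n"
  using det_non_zero_imp_unit[OF assms, of "()"]
  by (auto simp: Units_def ring_mat_def)

text \<open>Coordinates are obtained by applying the inverse \<open>Q\<close> of the matrix with
  columns \<open>B\<close>, so the matrix of rows is multiplied by the transpose of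
  \<open>Q\<close>. Thus \<open>B\<close> enters only through the constant \<open>d\<close>, namely
  \<open>det Q\<close>, which does not depend on \<open>vs\<close>.\<close>

lemma det_wrt_eq_det:
  fixes B :: "'a :: field vec list"
  assumes "ordered_basis k B"
  obtains d where "d \<noteq> 0"
    "\<And>vs. set vs \<subseteq> carrier_vec k \<Longrightarrow> length vs = k \<Longrightarrow> det_wrt k B vs = d * det (mat_of_rows k vs)"
proof -
  note B = ordered_basisD[OF assms]
  let ?A = "mat_of_cols k B"
  have A: "?A \<in> carrier_mat k k" using B by (simp add: carrier_matI)
  have "mat_of_rows k B = ?A\<^sup>T" by (simp add: transpose_mat_of_cols)
  hence "det ?A \<noteq> 0" using B det_transpose[OF A] by simp
  then obtain Q where Q: "Q \<in> carrier_mat k k" "?A * Q = 1\<^sub>m k" "Q * ?A = 1\<^sub>m k"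
    using invertible_matE[OF A] by blast
  have coord: "coord_vec k B v = Q *\<^sub>v v" if v: "v \<in> carrier_vec k" for v
    unfolding coord_vec_def
  proof (rule the_equality)
    have "?A *\<^sub>v (Q *\<^sub>v v) = (?A * Q) *\<^sub>v v"
      by (rule assoc_mult_mat_vec[OF A Q(1) v, symmetric])
    thus "Q *\<^sub>v v \<in> carrier_vec k \<and> ?A *\<^sub>v (Q *\<^sub>v v) = v" using Q v by simp
    fix c assume c: "c \<in> carrier_vec k \<and> ?A *\<^sub>v c = v"
    hence "Q *\<^sub>v v = (Q * ?A) *\<^sub>v c" using A Q by (metis assoc_mult_mat_vec)
    thus "c = Q *\<^sub>v v" using Q c by simp
  qed
  have "det Q * det ?A = 1" using det_mult[OF Q(1) A] Q(3) by simp
  hence nz: "det Q \<noteq> 0" by auto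
  have "det_wrt k B vs = det Q * det (mat_of_rows k vs)"
    if vs: "set vs \<subseteq> carrier_vec k" "length vs = k" for vs
  proof -
    have V: "mat_of_rows k vs \<in> carrier_mat k k" using vs by (simp add: carrier_matI)
    have "mat_of_rows k (map (coord_vec k B) vs) = mat_of_rows k vs * Q\<^sup>T"
    proof (rule eq_matI)
      fix i j assume "i < dim_row (mat_of_rows k vs * Q\<^sup>T)" "j < dim_col (mat_of_rows k vs * Q\<^sup>T)"
      hence ij: "i < k" "j < k" using vs Q by auto
      have vi: "vs ! i \<in> carrier_vec k" using ij vs by (auto simp: subset_iff)
      have "mat_of_rows k (map (coord_vec k B) vs) $$ (i, j) = row Q j \<bullet> vs ! i"
        using ij vs Q coord[OF vi] by (simp add: mat_of_rows_index)
      also have "\<dots> = vs ! i \<bullet> row Q j" using Q vi ij by (intro comm_scalar_prod) auto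
      also have "\<dots> = (mat_of_rows k vs * Q\<^sup>T) $$ (i, j)" using ij vs Q vi by simp
      finally show "mat_of_rows k (map (coord_vec k B) vs) $$ (i, j) = (mat_of_rows k vs * Q\<^sup>T) $$ (i, j)" .
    qed (use vs Q in auto)
    thus ?thesis using det_mult[OF V, of "Q\<^sup>T"] det_transpose[OF Q(1)] Q
      by (simp add: det_wrt_def)
  qed
  thus ?thesis using nz that by blast
qed

lemma det_mat_2:
  fixes f :: "nat \<Rightarrow> nat \<Rightarrow> 'a :: comm_ring_1"
  shows "det (mat 2 2 (\<lambda>(i, j). f i j)) = f 0 0 * f 1 1 - f 0 1 * f 1 0"
proof -
  let ?A = "mat 2 2 (\<lambda>(i, j). f i j)"
  have "det ?A = (\<Sum>j<2. ?A $$ (0, j) * cofactor ?A 0 j)"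
    by (rule laplace_expansion_row) auto
  thus ?thesis by (simp add: numeral_2_eq_2 cofactor_def det_single mat_delete_def)
qed

text \<open>This realises the plane obtained by factoring out the span of \<open>L\<close>. In
  coordinates with respect to \<open>s # w # L\<close> the rows of \<open>L\<close> become unit
  vectors, and only a 2 by 2 determinant remains.\<close>

lemma det_first_two_rows:
  fixes s w :: "'a :: field vec"
  assumes L: "set L \<subseteq> carrier_vec k" "length L + 2 = k"
    and sw: "s \<in> carrier_vec k" "w \<in> carrier_vec k" "det (mat_of_rows k (s # w # L)) \<noteq> 0"
  obtains a b where "a s = 1" "b s = 0"
    "\<And>x y. x \<in> carrier_vec k \<Longrightarrow> y \<in> carrier_vec k \<Longrightarrow>
      det (mat_of_rows k (y # x # L)) = det (mat_of_rows k (s # w # L)) * (a y * b x - b y * a x)"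
proof -
  let ?P = "mat_of_rows k (s # w # L)"
  have P: "?P \<in> carrier_mat k k" using L by (simp add: carrier_matI)
  obtain Q where Q: "Q \<in> carrier_mat k k" "?P * Q = 1\<^sub>m k" "Q * ?P = 1\<^sub>m k"
    using invertible_matE[OF P sw(3)] by blast
  have detQ: "det ?P * det Q = 1" using det_mult[OF P Q(1)] Q(2) by simp
  have PQ: "(s # w # L) ! i \<bullet> col Q j = (if i = j then 1 else 0)" if "i < k" "j < k" for i j
  proof -
    have "(s # w # L) ! i \<in> carrier_vec k" using that L sw
      by (auto simp: nth_Cons subset_iff split: nat.splits)
    hence "(?P * Q) $$ (i, j) = (s # w # L) ! i \<bullet> col Q j"
      using that L Q(1) by simp
    thus ?thesis using Q(2) that by simp
  qed
  \<comment> \<open>The coordinates along \<open>s\<close> and \<open>w\<close> with respect to the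
    basis \<open>s # w # L\<close>.\<close>
  define a b where "a y = y \<bullet> col Q 0" and "b y = y \<bullet> col Q 1" for y
  have k: "0 < k" "1 < k" using L by auto
  have "a s = 1" "b s = 0" using PQ[of 0 0] PQ[of 0 1] k by (auto simp: a_def b_def)
  moreover have "det (mat_of_rows k (y # x # L)) = det ?P * (a y * b x - b y * a x)"
    if xy: "x \<in> carrier_vec k" "y \<in> carrier_vec k" for x y
  proof -
    let ?N = "mat_of_rows k (y # x # L)"
    have N: "?N \<in> carrier_mat k k" using L by (simp add: carrier_matI)
    define f where "f i j = (y # x # L) ! i \<bullet> col Q j" for i j
    have NQ: "(?N * Q) $$ (i, j) = f i j" if "i < k" "j < k" for i j
    proof -
      have "(y # x # L) ! i \<in> carrier_vec k" using that L xy
        by (auto simp: nth_Cons subset_iff split: nat.splits)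
      thus ?thesis using that L Q(1) by (simp add: f_def)
    qed
    have f2: "f i j = (if i = j then 1 else 0)" if "2 \<le> i" "i < k" "j < k" for i j
    proof -
      obtain i' where "i = Suc (Suc i')" using \<open>2 \<le> i\<close> by (metis add_2_eq_Suc le_iff_add)
      thus ?thesis using PQ[of i j] that by (simp add: f_def)
    qed
    have "?N * Q = four_block_mat (mat 2 2 (\<lambda>(i, j). f i j)) (mat 2 (k - 2) (\<lambda>(i, j). f i (j + 2)))
        (0\<^sub>m (k - 2) 2) (1\<^sub>m (k - 2))" (is "_ = ?M")
    proof (rule eq_matI)
      fix i j assume "i < dim_row ?M" "j < dim_col ?M"
      hence ij: "i < k" "j < k" using L by auto
      show "(?N * Q) $$ (i, j) = ?M $$ (i, j)"
        unfolding NQ[OF ij] using ij k f2[of i j] le_add_diff_inverse2[of 2 j]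
        by (auto simp del: add_2_eq_Suc add_2_eq_Suc')
    qed (use N Q L in auto)
    hence "det (?N * Q) = det (mat 2 2 (\<lambda>(i, j). f i j)) * det (1\<^sub>m (k - 2) :: 'a mat)"
      by (simp only:) (rule det_four_block_mat_lower_left_zero, auto)
    hence "det ?N * det Q = f 0 0 * f 1 1 - f 0 1 * f 1 0"
      unfolding det_mult[OF N Q(1)] det_mat_2 by simp
    hence "(det ?P * det Q) * det ?N = det ?P * (f 0 0 * f 1 1 - f 0 1 * f 1 0)"
      by (simp add: mult_ac)
    thus ?thesis unfolding detQ by (simp add: f_def a_def b_def)
  qed
  ultimately show ?thesis by (rule that)
qed

section \<open>Row order and subfamilies of an arc\<close>

lemma det_swap_adjacent_rows:
  fixes a b :: "'a :: comm_ring_1 vec"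
  assumes "length p + length l + 2 = k"
  shows "det (mat_of_rows k (p @ a # b # l)) = - det (mat_of_rows k (p @ b # a # l))"
proof -
  let ?A = "mat_of_rows k (p @ b # a # l)"
  have A: "?A \<in> carrier_mat k k" using assms by (simp add: carrier_matI)
  have "mat_of_rows k (p @ a # b # l) = swaprows (length p) (Suc (length p)) ?A"
    using assms by (intro eq_matI) (auto simp: mat_of_rows_index nth_append nth_Cons split: nat.splits)
  thus ?thesis using det_swaprows[OF _ _ _ A] assms by simp
qed

text \<open>The row \<open>x\<close> passes the rows of \<open>l1\<close> one at a time, each swap
  costing a sign. This compares the inherited order of a subfamily with the order in which
  \<open>x\<close> stands directly below \<open>y\<close>.\<close>

lemma det_move_row:
  fixes x y :: "'a :: comm_ring_1 vec"
  assumes "length l1 + length l2 + 2 = k"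
  shows "det (mat_of_rows k (y # l1 @ x # l2))
       = (- 1) ^ length l1 * det (mat_of_rows k (y # x # l1 @ l2))"
  using assms
proof (induction l1 arbitrary: l2 rule: rev_induct)
  case (snoc z l1)
  show ?case using det_swap_adjacent_rows[of "y # l1" l2 k z x] snoc by simp
qed simp

text \<open>Locates the new member in the inherited order; the length of \<open>l1\<close>
  determines the sign in \<open>det_move_row\<close>.\<close>

lemma nths_insert:
  assumes "x < length G" "x \<notin> A"
  obtains l1 l2 where "nths G (insert x A) = l1 @ G ! x # l2" "nths G A = l1 @ l2"
proof -
  have "\<exists>l1 l2. nths G (insert x A) = l1 @ G ! x # l2 \<and> nths G A = l1 @ l2"
    using assms
  proof (induction G arbitrary: x A)
    case (Cons g G)
    show ?case
    proof (cases x)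
      case 0
      thus ?thesis using Cons.prems by (intro exI[of _ "[]"] exI[of _ "nths G {j. Suc j \<in> A}"]) (simp add: nths_Cons)
    next
      case (Suc x')
      have "{j. Suc j \<in> insert x A} = insert x' {j. Suc j \<in> A}" using Suc by auto
      moreover obtain l1 l2 where "nths G (insert x' {j. Suc j \<in> A}) = l1 @ G ! x' # l2"
          "nths G {j. Suc j \<in> A} = l1 @ l2"
        using Cons.IH[of x' "{j. Suc j \<in> A}"] Cons.prems Suc by auto
      ultimately show ?thesis using Suc
        by (intro exI[of _ "(if 0 \<in> A then [g] else []) @ l1"] exI[of _ l2]) (simp add: nths_Cons)
    qed
  qed simp
  thus ?thesis using that by blast
qed

text \<open>Two positions lie in a common set of \<open>k\<close> positions, whose vectors form a
  basis and hence are distinct. For \<open>k = 1\<close> repetitions are possible.\<close>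

lemma vec_arc_distinct:
  fixes H :: "'a :: field vec list"
  assumes "vec_arc k H" "2 \<le> k"
  shows "distinct H"
proof -
  have "H ! i \<noteq> H ! j" if ij: "i < length H" "j < length H" "i \<noteq> j" for i j
  proof
    assume eq: "H ! i = H ! j"
    have "\<exists>I. {i, j} \<subseteq> I \<and> I \<subseteq> {..<length H} \<and> card I = k"
      using assms ij by (intro exists_subset_between) (auto simp: vec_arc_def)
    then obtain I where I: "{i, j} \<subseteq> I" "I \<subseteq> {..<length H}" "card I = k" by blast
    hence "I \<in> subsets_of_size {..<length H} k"
      by (auto simp: subsets_of_size_def intro: finite_subset)
    hence dist: "distinct (nths H I)" using assms by (auto simp: vec_arc_def ordered_basis_def)
    obtain l1 l2 where l: "nths H (insert i (I - {i})) = l1 @ H ! i # l2" "nths H (I - {i}) = l1 @ l2"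
      using nths_insert[of i H "I - {i}"] ij by blast
    have "insert i (I - {i}) = I" using I by auto
    hence "H ! i \<notin> set (nths H (I - {i}))" using l dist by simp
    moreover have "H ! j \<in> set (nths H (I - {i}))" using I ij by (auto simp: set_nths)
    ultimately show False using eq by simp
  qed
  thus ?thesis by (simp add: distinct_conv_nth)
qed

text \<open>The definition of an arc covers only lists in the inherited order. Being a basis depends
  only on distinctness and the set of members, so \<open>L\<close> may be in any order.\<close>

lemma vec_arc_det_nonzero:
  fixes H :: "'a :: field vec list"
  assumes "vec_arc k H" "2 \<le> k" "distinct L" "set L \<subseteq> set H" "length L = k"
  shows "det (mat_of_rows k L) \<noteq> 0"
proof -
  define I where "I = {i. i < length H \<and> H ! i \<in> set L}"
  have nths: "nths H I = filter (\<lambda>x. x \<in> set L) H" by (simp add: filter_eq_nths I_def)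
  have set: "set (nths H I) = set L" using assms by (auto simp: nths)
  have d: "distinct (nths H I)" using vec_arc_distinct[OF assms(1,2)] by simp
  have "card I = length (nths H I)" by (simp add: length_nths I_def)
  also have "\<dots> = k" using distinct_card[OF d] distinct_card[OF assms(3)] set assms(5) by simp
  finally have "I \<in> subsets_of_size {..<length H} k"
    by (auto simp: subsets_of_size_def I_def)
  hence "ordered_basis k (nths H I)" using assms by (auto simp: vec_arc_def)
  hence "ordered_basis k L" using assms set by (simp add: ordered_basis_def)
  thus ?thesis by (rule ordered_basisD)
qed

section \<open>The row vector orthogonal to all columns\<close>

text \<open>The products run over vectors instead of positions, so positions in \<open>G\<close>
  need not be matched with positions in \<open>H\<close>; for lists without repetitions nothing is
  lost.\<close>

definition arc_kernel_vector ::
  "nat \<Rightarrow> 'a :: field vec list \<Rightarrow> 'a vec list \<Rightarrow> 'a vec list \<Rightarrow> nat set \<Rightarrow> 'a" where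
  "arc_kernel_vector k B H G C =
     inverse (\<Prod>y\<in>set H - set (nths G C). det_wrt k B (y # nths G C)) *
     inverse (\<Prod>y\<in>set G - set (nths G C). det_wrt k B (y # nths G C))"

lemma length_nths_subset: "C \<subseteq> {..<length G} \<Longrightarrow> length (nths G C) = card C"
  by (auto simp: length_nths intro!: arg_cong[where f = card])

lemma det_wrt_arc_nonzero:
  fixes G B H :: "'a :: field vec list"
  assumes "ordered_basis k B" "vec_arc k H" "set G \<subseteq> set H" "distinct G"
    and "2 \<le> k" "C \<in> arc_rows k G" "y \<in> set H - set (nths G C)"
  shows "det_wrt k B (y # nths G C) \<noteq> 0"
proof -
  obtain d where d: "d \<noteq> 0" "\<And>vs. set vs \<subseteq> carrier_vec k \<Longrightarrow> length vs = k \<Longrightarrow>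
      det_wrt k B vs = d * det (mat_of_rows k vs)"
    using det_wrt_eq_det[OF assms(1)] by blast
  have sub: "set (y # nths G C) \<subseteq> set H"
    using assms set_nths_subset[of G C] by auto
  have len: "length (y # nths G C) = k"
    using assms(6) by (simp add: arc_rows_def length_nths_subset)
  have "det (mat_of_rows k (y # nths G C)) \<noteq> 0"
    using assms by (intro vec_arc_det_nonzero[OF assms(2,5) _ sub len]) auto
  moreover have "set (y # nths G C) \<subseteq> carrier_vec k"
    using sub assms(2) unfolding vec_arc_def by blast
  ultimately show ?thesis using d(1) d(2)[OF _ len] by simp
qed

lemma arc_kernel_vector_nonzero:
  fixes G B H :: "'a :: field vec list"
  assumes "ordered_basis k B" "vec_arc k H" "set G \<subseteq> set H" "distinct G"
    and "2 \<le> k" "C \<in> arc_rows k G"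
  shows "arc_kernel_vector k B H G C \<noteq> 0"
  using det_wrt_arc_nonzero[OF assms] assms(3)
  by (auto simp: arc_kernel_vector_def)

text \<open>Only the rows \<open>insert i A\<close> with \<open>i\<close> outside \<open>U\<close>
  and \<open>A\<close> contribute. There the matrix entry cancels the factors from \<open>U\<close>
  in the second product, and a summand of the plane identity remains.\<close>

lemma arc_kernel_vector_orthogonal:
  fixes G B H :: "'a :: {field, finite} vec list"
  assumes B: "ordered_basis k B" and H: "vec_arc k H" and GH: "set G \<subseteq> set H" and dG: "distinct G"
    and size: "length H + length G + 1 = CARD('a) + 2 * k + n"
    and UA: "(U, A) \<in> arc_cols k n G"
  shows "(\<Sum>C\<in>arc_rows k G. arc_kernel_vector k B H G C * arc_matrix k B G C (U, A)) = 0"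
proof -
  have U: "U \<subseteq> {..<length G}" "finite U" "card U = n"
    and A: "A \<subseteq> {..<length G} - U" "card A + 2 = k"
    using UA by (auto simp: arc_cols_def subsets_of_size_def)
  have k2: "2 \<le> k" and finA: "finite A" using A by (auto intro: finite_subset)
  have dH: "distinct H" using vec_arc_distinct[OF H k2] .
  have carH: "set H \<subseteq> carrier_vec k" using H by (simp add: vec_arc_def)
  obtain d where d: "d \<noteq> 0" "\<And>vs. set vs \<subseteq> carrier_vec k \<Longrightarrow> length vs = k \<Longrightarrow>
      det_wrt k B vs = d * det (mat_of_rows k vs)"
    using det_wrt_eq_det[OF B] by blast
  \<comment> \<open>\<open>E\<close> holds the positions that can extend \<open>A\<close> to a
    contributing row. \<open>S\<close> and \<open>X\<close> become the two sets of the plane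
    identity modulo the span of \<open>L\<close>.\<close>
  define L E where "L = nths G A" and "E = {..<length G} - U - A"
  define S X where "S = (!) G ` E" and "X = set H - set L"
  define D where "D y x = d * det (mat_of_rows k (y # x # L))" for y x
  have injG: "inj_on ((!) G) {..<length G}"
    using dG by (simp add: inj_on_nth)
  have setL: "set L = (!) G ` A" using A by (auto simp: L_def set_nths)
  have LG: "set L \<subseteq> set G" by (simp add: L_def set_nths_subset)
  have dL: "distinct L" using dG by (simp add: L_def)
  have lenL: "length L + 2 = k" using A by (subst L_def, subst length_nths_subset) auto
  have SX: "S \<subseteq> X"
  proof
    fix x assume "x \<in> S"
    then obtain i where i: "i \<in> E" "x = G ! i" by (auto simp: S_def)
    have "x \<notin> set L"
      using i A injG by (auto simp: setL E_def inj_on_def)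
    thus "x \<in> X" using i GH by (auto simp: X_def E_def)
  qed
  have cardE: "card E + card U + card A = length G"
  proof -
    have "{..<length G} = E \<union> (U \<union> A)" using U A by (auto simp: E_def)
    moreover have "card (E \<union> (U \<union> A)) = card E + card (U \<union> A)"
      using U finA by (intro card_Un_disjoint) (auto simp: E_def)
    moreover have "card (U \<union> A) = card U + card A"
      using U finA A by (intro card_Un_disjoint) auto
    ultimately show ?thesis by (metis add.assoc card_lessThan)
  qed
  have cardS: "card S = card E"
    unfolding S_def by (intro card_image inj_on_subset[OF injG]) (auto simp: E_def)
  have cardX: "card X + length L = length H"
    using LG GH dL dH card_mono[of "set H" "set L"]
    by (simp add: X_def card_Diff_subset distinct_card)
  \<comment> \<open>\<open>X\<close> has \<open>length H - (k - 2)\<close> members and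
    \<open>S\<close> has \<open>length G - n - (k - 2)\<close>; the forbidden size of
    \<open>H\<close> is exactly the one giving this total.\<close>
  have card: "card X + card S = CARD('a) + 3"
    using cardE cardS cardX size U(3) A(2) lenL by linarith
  have finX: "finite X" by (simp add: X_def)
  have Dnz: "D y x \<noteq> 0" if "x \<in> X" "y \<in> X" "x \<noteq> y" for x y
  proof -
    have "det (mat_of_rows k (y # x # L)) \<noteq> 0"
      using that dL LG GH lenL by (intro vec_arc_det_nonzero[OF H k2]) (auto simp: X_def)
    thus ?thesis using d(1) by (simp add: D_def)
  qed
  have plane: "(\<Sum>x\<in>S. inverse (\<Prod>y\<in>X - {x}. D y x) * inverse (\<Prod>y\<in>S - {x}. D y x)) = 0"
  proof (cases "S = {}")
    case False
    then obtain s where s: "s \<in> S" by blast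
    \<comment> \<open>At least two members of \<open>H\<close> lie outside the \<open>k - 2\<close>
      members of \<open>L\<close>. The second one, \<open>w\<close>, completes \<open>s\<close> and
      \<open>L\<close> to a basis; \<open>s\<close> itself becomes the point at infinity.\<close>
    have "k \<le> length H" using H by (simp add: vec_arc_def)
    hence "2 \<le> card X" using cardX lenL by linarith
    hence "card (X - {s}) \<noteq> 0" using s SX finX by (simp add: card_Diff_singleton subset_iff)
    then obtain w where w: "w \<in> X" "w \<noteq> s" by (metis Diff_iff card.empty equals0I singletonI)
    have carX: "X \<subseteq> carrier_vec k" using carH by (auto simp: X_def)
    have "det (mat_of_rows k (s # w # L)) \<noteq> 0"
      using Dnz[of w s] w s SX d(1) by (auto simp: D_def)
    then obtain a b where ab: "a s = 1" "b s = 0"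
      "\<And>x y. x \<in> carrier_vec k \<Longrightarrow> y \<in> carrier_vec k \<Longrightarrow>
        det (mat_of_rows k (y # x # L)) = det (mat_of_rows k (s # w # L)) * (a y * b x - b y * a x)"
      using det_first_two_rows[of L k s w] LG GH carH lenL carX w s SX
      by (metis subset_iff)
    show ?thesis
    proof (rule plane_double_product_sum[OF finX SX s card])
      show "D y x = D s w * (a y * b x - b y * a x)" if "x \<in> X" "y \<in> X" for x y
        using ab(3)[of x y] that carX by (auto simp: D_def)
    qed (use Dnz ab in auto)
  qed simp
  have summand: "arc_kernel_vector k B H G (insert i A) * arc_matrix k B G (insert i A) (U, A)
      = inverse (\<Prod>y\<in>X - {x}. D y x) * inverse (\<Prod>y\<in>S - {x}. D y x)"
    if i: "i \<in> E" and x: "x = G ! i" for i x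
  proof -
    let ?C = "insert i A"
    define F where "F y = det_wrt k B (y # nths G ?C)" for y
    have iG: "i < length G" "i \<notin> A" "i \<notin> U" using i by (auto simp: E_def)
    obtain l1 l2 where l: "nths G ?C = l1 @ x # l2" "L = l1 @ l2"
      using nths_insert[OF iG(1,2)] unfolding L_def x by blast
    \<comment> \<open>The sign of moving \<open>x\<close> from its inherited place to the front of
      the row list; it does not depend on \<open>y\<close>.\<close>
    define e where "e = (- 1 :: 'a) ^ length l1"
    have e2: "e\<^sup>2 = 1" by (simp add: e_def power_mult[symmetric] mult.commute[of _ 2])
    have C: "?C \<in> arc_rows k G" using iG A finA by (auto simp: arc_rows_def)
    have setC: "set (nths G ?C) = insert x (set L)" using l by auto
    have xS: "x \<in> S" using i x by (auto simp: S_def)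
    have FD: "F y = e * D y x" if "y \<in> set H" for y
    proof -
      have "set (nths G ?C) \<subseteq> carrier_vec k"
        using set_nths_subset[of G ?C] GH carH by blast
      hence "F y = d * det (mat_of_rows k (y # nths G ?C))"
        unfolding F_def using that carH l lenL by (intro d(2)) auto
      also have "det (mat_of_rows k (y # nths G ?C)) = e * det (mat_of_rows k (y # x # L))"
        unfolding l e_def using l lenL by (intro det_move_row) simp
      finally show ?thesis by (simp add: D_def)
    qed
    have prodF: "(\<Prod>y\<in>Y. F y) = e ^ card Y * (\<Prod>y\<in>Y. D y x)" if "Y \<subseteq> set H" for Y
    proof -
      have "(\<Prod>y\<in>Y. F y) = (\<Prod>y\<in>Y. e * D y x)" using that FD by (intro prod.cong) auto
      thus ?thesis by (simp add: prod.distrib)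
    qed
    have Fnz: "F y \<noteq> 0" if "y \<in> set H - insert x (set L)" for y
      using det_wrt_arc_nonzero[OF B H GH dG k2 C, of y] that by (simp add: setC F_def)
    let ?V = "(!) G ` U"
    have injU: "inj_on ((!) G) U" using injG U(1) inj_on_subset by blast
    have VG: "set G - insert x (set L) = (S - {x}) \<union> ?V"
    proof -
      have "set G = (!) G ` {..<length G}" by (auto simp: set_conv_nth)
      also have "{..<length G} = E \<union> A \<union> U" using U A by (auto simp: E_def)
      finally have G: "set G = S \<union> set L \<union> ?V" by (simp add: S_def setL image_Un)
      have "?V \<inter> insert x (set L) = {}"
        using U(1) A(1) iG injG unfolding setL x inj_on_def by blast
      thus ?thesis using G SX by (auto simp: X_def)
    qed
    have disj: "(S - {x}) \<inter> ?V = {}"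
      using U(1) injG unfolding S_def E_def inj_on_def by blast
    have finS: "finite S" using finX SX finite_subset by blast
    \<comment> \<open>Needed to cancel the matrix entry against its inverse in the row
      vector.\<close>
    have Vnz: "(\<Prod>y\<in>?V. F y) \<noteq> 0"
    proof -
      have "?V \<subseteq> set H - insert x (set L)" using VG GH by blast
      thus ?thesis using Fnz U(2) by (auto simp: prod_zero_iff subset_iff)
    qed
    have "(\<Prod>y\<in>set G - set (nths G ?C). F y) = (\<Prod>y\<in>S - {x}. F y) * (\<Prod>y\<in>?V. F y)"
      unfolding setC VG using disj finS U(2) by (intro prod.union_disjoint) auto
    moreover have "arc_matrix k B G ?C (U, A) = (\<Prod>y\<in>?V. F y)"
      using A iG by (auto simp: arc_matrix_def F_def prod.reindex[OF injU])
    ultimately have "arc_kernel_vector k B H G ?C * arc_matrix k B G ?C (U, A)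
        = inverse (\<Prod>y\<in>set H - set (nths G ?C). F y) * inverse (\<Prod>y\<in>S - {x}. F y)"
      using Vnz by (simp add: arc_kernel_vector_def F_def[symmetric])
    also have "set H - set (nths G ?C) = X - {x}" by (auto simp: setC X_def)
    also have "inverse (\<Prod>y\<in>X - {x}. F y) * inverse (\<Prod>y\<in>S - {x}. F y)
        = inverse (e ^ (card (X - {x}) + card (S - {x}))) *
          (inverse (\<Prod>y\<in>X - {x}. D y x) * inverse (\<Prod>y\<in>S - {x}. D y x))"
    proof -
      have "X - {x} \<subseteq> set H" "S - {x} \<subseteq> set H" using SX by (auto simp: X_def)
      thus ?thesis by (simp add: prodF power_add mult_ac)
    qed
    \<comment> \<open>The sign \<open>e\<close> occurs once for each determinant, so its exponent is
      this number and it disappears.\<close>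
    also have "card (X - {x}) + card (S - {x}) = CARD('a) + 1"
      using card card_Suc_Diff1[OF finS xS] card_Suc_Diff1[OF finX subsetD[OF SX xS]] by linarith
    also have "e ^ (CARD('a) + 1) = 1" by (simp only: finite_field_power_card_plus_1 e2)
    finally show ?thesis by simp
  qed
  have injA: "inj_on (\<lambda>i. insert i A) E" by (auto simp: inj_on_def E_def)
  have "(\<Sum>C\<in>arc_rows k G. arc_kernel_vector k B H G C * arc_matrix k B G C (U, A))
      = (\<Sum>C\<in>(\<lambda>i. insert i A) ` E. arc_kernel_vector k B H G C * arc_matrix k B G C (U, A))"
  proof (rule sum.mono_neutral_right)
    show "finite (arc_rows k G)" by (rule finite_subset[of _ "Pow {..<length G}"]) (auto simp: arc_rows_def)
    show "(\<lambda>i. insert i A) ` E \<subseteq> arc_rows k G"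
      using A finA by (auto simp: arc_rows_def E_def)
    show "\<forall>C\<in>arc_rows k G - (\<lambda>i. insert i A) ` E.
        arc_kernel_vector k B H G C * arc_matrix k B G C (U, A) = 0"
    proof
      fix C assume C: "C \<in> arc_rows k G - (\<lambda>i. insert i A) ` E"
      \<comment> \<open>A row containing \<open>A\<close> has exactly one further position, which
        would lie in \<open>E\<close> if the row avoided \<open>U\<close>.\<close>
      have "\<not> (A \<subseteq> C \<and> C \<subseteq> {..<length G} - U)"
      proof
        assume AC: "A \<subseteq> C \<and> C \<subseteq> {..<length G} - U"
        have "card (C - A) = 1"
          using C A finA AC by (auto simp: arc_rows_def card_Diff_subset)
        then obtain i where i: "C - A = {i}" by (auto simp: card_1_singleton_iff)
        hence "C = insert i A" "i \<in> E" using AC by (auto simp: E_def)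
        thus False using C by auto
      qed
      thus "arc_kernel_vector k B H G C * arc_matrix k B G C (U, A) = 0"
        by (auto simp: arc_matrix_def)
    qed
  qed
  also have "\<dots> = (\<Sum>i\<in>E. inverse (\<Prod>y\<in>X - {G ! i}. D y (G ! i)) * inverse (\<Prod>y\<in>S - {G ! i}. D y (G ! i)))"
    by (simp add: sum.reindex[OF injA] summand)
  also have "\<dots> = (\<Sum>x\<in>S. inverse (\<Prod>y\<in>X - {x}. D y x) * inverse (\<Prod>y\<in>S - {x}. D y x))"
  proof -
    have "inj_on ((!) G) E" by (rule inj_on_subset[OF injG]) (auto simp: E_def)
    thus ?thesis by (simp add: S_def sum.reindex)
  qed
  also have "\<dots> = 0" by (rule plane)
  finally show ?thesis .
qed

section \<open>Pairing a vector of weight one with the row vector\<close>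

theorem theorem1p15:
  fixes k n :: nat
    and G B :: "'a :: {field, finite} vec list"
  assumes "ordered_basis k B"
    and "vec_arc k G"
    and "real n + real k - 1 \<le> real (length G)"
    and "real (length G) \<le> (real CARD('a) + 2 * real k - 2 + real n) / 2"
    and "\<exists>v \<in> column_space (arc_rows k G) (arc_cols k n G) (arc_matrix k B G).
           weight (arc_rows k G) v = 1"
  shows "\<not> (\<exists>H :: 'a vec list. vec_arc k H \<and> subseq G H \<and>
           int (length H) = int CARD('a) + 2 * int k - 1 + int n - int (length G))"
proof
  assume "\<exists>H :: 'a vec list. vec_arc k H \<and> subseq G H \<and>
           int (length H) = int CARD('a) + 2 * int k - 1 + int n - int (length G)"
  then obtain H :: "'a vec list" where H: "vec_arc k H" "subseq G H"
    and size: "int (length H) = int CARD('a) + 2 * int k - 1 + int n - int (length G)"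
    by blast
  let ?R = "arc_rows k G" and ?S = "arc_cols k n G" and ?M = "arc_matrix k B G"
  let ?b = "arc_kernel_vector k B H G"
  obtain v z where v: "v = (\<lambda>r. if r \<in> ?R then \<Sum>s\<in>?S. z s * ?M r s else 0)"
    and weight: "weight ?R v = 1"
    using assms(5) by (auto simp: column_space_def)
  obtain C where C: "{r \<in> ?R. v r \<noteq> 0} = {C}"
    using weight by (auto simp: weight_def card_1_singleton_iff)
  have vC: "C \<in> ?R" "v C \<noteq> 0" "\<And>r. r \<in> ?R \<Longrightarrow> r \<noteq> C \<Longrightarrow> v r = 0"
    using C by blast+
  \<comment> \<open>Without columns the column space is zero, so a vector of weight one forces
    \<open>2 \<le> k\<close>.\<close>
  have "?S \<noteq> {}" using vC(1,2) by (auto simp: v)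
  hence k2: "2 \<le> k" by (auto simp: arc_cols_def)
  have GH: "set G \<subseteq> set H" using H(2) by (metis notin_set_nthsI subseq_conv_nths subsetI)
  have dG: "distinct G" using vec_arc_distinct[OF assms(2) k2] .
  have finR: "finite ?R" by (rule finite_subset[of _ "Pow {..<length G}"]) (auto simp: arc_rows_def)
  have size': "length H + length G + 1 = CARD('a) + 2 * k + n" using size by linarith
  \<comment> \<open>The pairing is evaluated twice: by columns it vanishes, while by rows only the
    single nonzero coordinate \<open>C\<close> survives.\<close>
  have "(\<Sum>r\<in>?R. ?b r * v r) = (\<Sum>r\<in>?R. \<Sum>s\<in>?S. z s * (?b r * ?M r s))"
    by (simp add: v sum_distrib_left mult_ac)
  also have "\<dots> = (\<Sum>s\<in>?S. z s * (\<Sum>r\<in>?R. ?b r * ?M r s))"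
    by (subst sum.swap) (simp add: sum_distrib_left)
  also have "\<dots> = 0"
    using arc_kernel_vector_orthogonal[OF assms(1) H(1) GH dG size']
    by (intro sum.neutral ballI) (auto split: prod.splits)
  finally have "(\<Sum>r\<in>?R. ?b r * v r) = 0" .
  moreover have "(\<Sum>r\<in>?R. ?b r * v r) = (\<Sum>r\<in>{C}. ?b r * v r)"
    using vC by (intro sum.mono_neutral_right finR) auto
  ultimately have "?b C * v C = 0" by simp
  thus False
    using vC arc_kernel_vector_nonzero[OF assms(1) H(1) GH dG k2 vC(1)] by simp
qed

end
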